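(* For each $\mathcal{S}\in\{\mathbb{T},\mathbb{D},\mathbb{V},\mathbb{L}\}$, the game $G$ is not sound for $\equiv$ on $\mathcal{S}$: there exist model-defining $\mathcal{S}$-interpretations $\pi,\pi'$ (with infinite universes) such that Duplicator has a winning strategy in $G(\pi,\pi')$ but $\pi\not\equiv\pi'$.
   Context: Semirings: tropical $\mathbb{T}=(\mathbb{R}_+^\infty,\min,+,\infty,0)$; Viterbi $\mathbb{V}=([0,1],\max,\cdot,0,1)$; Łukasiewicz $\mathbb{L}=([0,1],\max,\odot,0,1)$ with $s\odot t=\max(s+t-1,0)$; doubt $\mathbb{D}=([0,1],\min,\oplus,1,0)$ with $s\oplus t=\min(s+t,1)$ (listed as (carrier, addition, multiplication, zero, one)). These are absorptive; infinite sums are suprema and infinite products infima, with respect to the natural order ($s\le t$ iff $s+r=t$ for some $r$), of finite partial sums/products. For a finite relational vocabulary $\tau$ and universe $A$, an $\mathcal{S}$-interpretation is a map $\pi$ from the literals $R\bar a,\neg R\bar a$ to $\mathcal{S}$; model-defining if exactly one of $\pi(R\bar a),\pi(\neg R\bar a)$ is the semiring zero for every atom. Formulae in negation normal form are evaluated with equalities by truth value (semiring one/zero), literals by $\pi$, $\vee,\exists$ by semiring sums, $\wedge,\forall$ by semiring products over the universe; $\equiv$: equal values for all sentences. In $G(\pi,\pi')$ Spoiler first chooses $m\in\mathbb{N}$; then in $m$ rounds Spoiler picks an element of one universe and Duplicator one of the other; Duplicator wins iff the resulting map of tuples is a local isomorphism (same equality pattern, equal values on all $\tau$-literals). *)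

theory Defs
  imports "HOL-Algebra.Ring" "HOL-Algebra.Lattice" "HOL-Library.Extended_Nonnegative_Real"
begin

section \<open>The four semirings\<close>

definition tropical :: "ennreal ring" where
  "tropical = \<lparr>carrier = UNIV, mult = (+), one = 0, zero = \<infinity>, add = min\<rparr>"

definition viterbi :: "real ring" where
  "viterbi = \<lparr>carrier = {0..1}, mult = (*), one = 1, zero = 0, add = max\<rparr>"

definition lukasiewicz :: "real ring" where
  "lukasiewicz =
    \<lparr>carrier = {0..1}, mult = (\<lambda>s t. max (s + t - 1) 0), one = 1, zero = 0, add = max\<rparr>"

definition doubt :: "real ring" where
  "doubt = \<lparr>carrier = {0..1}, mult = (\<lambda>s t. min (s + t) 1), one = 0, zero = 1, add = min\<rparr>"


section \<open>Infinitary sums and products\<close>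

text \<open>On the tropical and the doubt semiring the natural order is the reverse of the
  usual order of the numbers.\<close>

definition natural_order :: "'s ring \<Rightarrow> 's gorder" where
  "natural_order S =
    \<lparr>carrier = carrier S, eq = (=), le = (\<lambda>s t. \<exists>r\<in>carrier S. s \<oplus>\<^bsub>S\<^esub> r = t)\<rparr>"

definition inf_sum :: "'s ring \<Rightarrow> ('i \<Rightarrow> 's) \<Rightarrow> 'i set \<Rightarrow> 's" where
  "inf_sum S f I = supr (natural_order S) {F. finite F \<and> F \<subseteq> I} (\<lambda>F. finsum S f F)"

definition inf_prod :: "'s ring \<Rightarrow> ('i \<Rightarrow> 's) \<Rightarrow> 'i set \<Rightarrow> 's" where
  "inf_prod S f I = infi (natural_order S) {F. finite F \<and> F \<subseteq> I} (\<lambda>F. finprod S f F)"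


section \<open>Interpretations\<close>

text \<open>A relational vocabulary maps its relation symbols to their arities.\<close>

type_synonym 'r vocab = "'r \<rightharpoonup> nat"

datatype ('r, 'a) literal = Pos 'r "'a list" | Neg 'r "'a list"

definition literals :: "'r vocab \<Rightarrow> 'a set \<Rightarrow> ('r, 'a) literal set" where
  "literals \<tau> A =
    {l. \<exists>R as. \<tau> R = Some (length as) \<and> set as \<subseteq> A \<and> (l = Pos R as \<or> l = Neg R as)}"

type_synonym ('r, 'a, 's) interp = "('r, 'a) literal \<Rightarrow> 's"

definition interpretation_on ::
    "'s ring \<Rightarrow> 'r vocab \<Rightarrow> 'a set \<Rightarrow> ('r, 'a, 's) interp \<Rightarrow> bool" where
  "interpretation_on S \<tau> A \<pi> \<longleftrightarrow> (\<forall>l\<in>literals \<tau> A. \<pi> l \<in> carrier S)"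

definition model_defining ::
    "'s ring \<Rightarrow> 'r vocab \<Rightarrow> 'a set \<Rightarrow> ('r, 'a, 's) interp \<Rightarrow> bool" where
  "model_defining S \<tau> A \<pi> \<longleftrightarrow>
    (\<forall>R as. \<tau> R = Some (length as) \<and> set as \<subseteq> A \<longrightarrow>
      (\<pi> (Pos R as) = \<zero>\<^bsub>S\<^esub>) \<noteq> (\<pi> (Neg R as) = \<zero>\<^bsub>S\<^esub>))"


section \<open>First-order formulae in negation normal form\<close>

datatype 'r fm =
    Eq nat nat
  | Neq nat nat
  | Rel 'r "nat list"
  | NRel 'r "nat list"
  | Or "'r fm" "'r fm"
  | And "'r fm" "'r fm"
  | Ex nat "'r fm"
  | All nat "'r fm"

primrec fv :: "'r fm \<Rightarrow> nat set" where
  "fv (Eq x y) = {x, y}"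
| "fv (Neq x y) = {x, y}"
| "fv (Rel R xs) = set xs"
| "fv (NRel R xs) = set xs"
| "fv (Or \<phi> \<psi>) = fv \<phi> \<union> fv \<psi>"
| "fv (And \<phi> \<psi>) = fv \<phi> \<union> fv \<psi>"
| "fv (Ex x \<phi>) = fv \<phi> - {x}"
| "fv (All x \<phi>) = fv \<phi> - {x}"

primrec in_vocab :: "'r vocab \<Rightarrow> 'r fm \<Rightarrow> bool" where
  "in_vocab \<tau> (Eq x y) \<longleftrightarrow> True"
| "in_vocab \<tau> (Neq x y) \<longleftrightarrow> True"
| "in_vocab \<tau> (Rel R xs) \<longleftrightarrow> \<tau> R = Some (length xs)"
| "in_vocab \<tau> (NRel R xs) \<longleftrightarrow> \<tau> R = Some (length xs)"
| "in_vocab \<tau> (Or \<phi> \<psi>) \<longleftrightarrow> in_vocab \<tau> \<phi> \<and> in_vocab \<tau> \<psi>"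
| "in_vocab \<tau> (And \<phi> \<psi>) \<longleftrightarrow> in_vocab \<tau> \<phi> \<and> in_vocab \<tau> \<psi>"
| "in_vocab \<tau> (Ex x \<phi>) \<longleftrightarrow> in_vocab \<tau> \<phi>"
| "in_vocab \<tau> (All x \<phi>) \<longleftrightarrow> in_vocab \<tau> \<phi>"

definition sentence :: "'r vocab \<Rightarrow> 'r fm \<Rightarrow> bool" where
  "sentence \<tau> \<phi> \<longleftrightarrow> in_vocab \<tau> \<phi> \<and> fv \<phi> = {}"

text \<open>Assignments are partial maps, so that sentences are evaluated under the empty
  assignment.\<close>

primrec value_fm ::
    "'s ring \<Rightarrow> 'a set \<Rightarrow> ('r, 'a, 's) interp \<Rightarrow> (nat \<rightharpoonup> 'a) \<Rightarrow> 'r fm \<Rightarrow> 's" where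
  "value_fm S A \<pi> \<beta> (Eq x y) = (if \<beta> x = \<beta> y then \<one>\<^bsub>S\<^esub> else \<zero>\<^bsub>S\<^esub>)"
| "value_fm S A \<pi> \<beta> (Neq x y) = (if \<beta> x \<noteq> \<beta> y then \<one>\<^bsub>S\<^esub> else \<zero>\<^bsub>S\<^esub>)"
| "value_fm S A \<pi> \<beta> (Rel R xs) = \<pi> (Pos R (map (\<lambda>x. the (\<beta> x)) xs))"
| "value_fm S A \<pi> \<beta> (NRel R xs) = \<pi> (Neg R (map (\<lambda>x. the (\<beta> x)) xs))"
| "value_fm S A \<pi> \<beta> (Or \<phi> \<psi>) = value_fm S A \<pi> \<beta> \<phi> \<oplus>\<^bsub>S\<^esub> value_fm S A \<pi> \<beta> \<psi>"
| "value_fm S A \<pi> \<beta> (And \<phi> \<psi>) = value_fm S A \<pi> \<beta> \<phi> \<otimes>\<^bsub>S\<^esub> value_fm S A \<pi> \<beta> \<psi>"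
| "value_fm S A \<pi> \<beta> (Ex x \<phi>) = inf_sum S (\<lambda>a. value_fm S A \<pi> (\<beta>(x \<mapsto> a)) \<phi>) A"
| "value_fm S A \<pi> \<beta> (All x \<phi>) = inf_prod S (\<lambda>a. value_fm S A \<pi> (\<beta>(x \<mapsto> a)) \<phi>) A"

definition sentence_value ::
    "'s ring \<Rightarrow> 'a set \<Rightarrow> ('r, 'a, 's) interp \<Rightarrow> 'r fm \<Rightarrow> 's" where
  "sentence_value S A \<pi> \<phi> = value_fm S A \<pi> Map.empty \<phi>"

definition elem_equiv ::
    "'s ring \<Rightarrow> 'r vocab \<Rightarrow> 'a set \<Rightarrow> ('r, 'a, 's) interp
      \<Rightarrow> 'b set \<Rightarrow> ('r, 'b, 's) interp \<Rightarrow> bool" where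
  "elem_equiv S \<tau> A \<pi> B \<pi>' \<longleftrightarrow>
    (\<forall>\<phi>. sentence \<tau> \<phi> \<longrightarrow> sentence_value S A \<pi> \<phi> = sentence_value S B \<pi>' \<phi>)"


section \<open>The game\<close>

text \<open>A position is the list of the pairs of elements chosen so far. The literals over the
  chosen elements are those obtained by instantiating indices into this list.\<close>

definition local_iso ::
    "'r vocab \<Rightarrow> ('r, 'a, 's) interp \<Rightarrow> ('r, 'b, 's) interp \<Rightarrow> ('a \<times> 'b) list \<Rightarrow> bool" where
  "local_iso \<tau> \<pi> \<pi>' p \<longleftrightarrow>
    (\<forall>i<length p. \<forall>j<length p. fst (p ! i) = fst (p ! j) \<longleftrightarrow> snd (p ! i) = snd (p ! j)) \<and>
    (\<forall>R js. \<tau> R = Some (length js) \<and> set js \<subseteq> {..<length p} \<longrightarrow>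
      \<pi> (Pos R (map (\<lambda>j. fst (p ! j)) js)) = \<pi>' (Pos R (map (\<lambda>j. snd (p ! j)) js)) \<and>
      \<pi> (Neg R (map (\<lambda>j. fst (p ! j)) js)) = \<pi>' (Neg R (map (\<lambda>j. snd (p ! j)) js)))"

text \<open>A strategy of Duplicator consists of an answer in \<open>B\<close> to each element of
  \<open>A\<close>, and an answer in \<open>A\<close> to each element of \<open>B\<close>, at every position.\<close>

inductive consistent ::
    "'a set \<Rightarrow> 'b set \<Rightarrow> (('a \<times> 'b) list \<Rightarrow> 'a \<Rightarrow> 'b) \<Rightarrow> (('a \<times> 'b) list \<Rightarrow> 'b \<Rightarrow> 'a)
      \<Rightarrow> ('a \<times> 'b) list \<Rightarrow> bool"
  for A B f g where
  start: "consistent A B f g []"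
| left: "consistent A B f g p \<Longrightarrow> a \<in> A \<Longrightarrow> consistent A B f g (p @ [(a, f p a)])"
| right: "consistent A B f g p \<Longrightarrow> b \<in> B \<Longrightarrow> consistent A B f g (p @ [(g p b, b)])"

definition winning_strategy ::
    "'r vocab \<Rightarrow> 'a set \<Rightarrow> ('r, 'a, 's) interp \<Rightarrow> 'b set \<Rightarrow> ('r, 'b, 's) interp \<Rightarrow> nat
      \<Rightarrow> (('a \<times> 'b) list \<Rightarrow> 'a \<Rightarrow> 'b) \<Rightarrow> (('a \<times> 'b) list \<Rightarrow> 'b \<Rightarrow> 'a) \<Rightarrow> bool" where
  "winning_strategy \<tau> A \<pi> B \<pi>' m f g \<longleftrightarrow>
    (\<forall>p. \<forall>a\<in>A. f p a \<in> B) \<and> (\<forall>p. \<forall>b\<in>B. g p b \<in> A) \<and>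
    (\<forall>p. consistent A B f g p \<and> length p = m \<longrightarrow> local_iso \<tau> \<pi> \<pi>' p)"

text \<open>Spoiler announces the number \<open>m\<close> of rounds first, so Duplicator's strategy may
  depend on it.\<close>

definition duplicator_wins_G ::
    "'r vocab \<Rightarrow> 'a set \<Rightarrow> ('r, 'a, 's) interp \<Rightarrow> 'b set \<Rightarrow> ('r, 'b, 's) interp \<Rightarrow> bool" where
  "duplicator_wins_G \<tau> A \<pi> B \<pi>' \<longleftrightarrow>
    (\<exists>f g. \<forall>m. winning_strategy \<tau> A \<pi> B \<pi>' m (f m) (g m))"

text \<open>The type of the universes and of the relation symbols has to be fixed for the
  existential quantifiers; with \<open>nat\<close> the counterexamples are countable.\<close>

definition G_not_sound :: "'s ring \<Rightarrow> bool" where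
  "G_not_sound S \<longleftrightarrow>
    (\<exists>(\<tau> :: nat vocab) (A :: nat set) (B :: nat set) \<pi> \<pi>'.
      finite (dom \<tau>) \<and> infinite A \<and> infinite B \<and>
      interpretation_on S \<tau> A \<pi> \<and> interpretation_on S \<tau> B \<pi>' \<and>
      model_defining S \<tau> A \<pi> \<and> model_defining S \<tau> B \<pi>' \<and>
      duplicator_wins_G \<tau> A \<pi> B \<pi>' \<and> \<not> elem_equiv S \<tau> A \<pi> B \<pi>')"

end

theory Submission
  imports Defs "HOL-Library.Nat_Bijection"
begin

text \<open>
  Each of the four semirings embeds, by a bijection \<open>cost\<close> reversing the natural order, into
  an interval \<open>[0, c]\<close> with \<open>c \<ge> 1\<close>, addition becoming the minimum and multiplication
  the sum truncated at \<open>c\<close>; infinite sums and products are then infima and truncated sums of costs.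

  The universe is a disjoint union of blocks, and \<open>R(x, y)\<close> costs the weight of \<open>y\<close> if
  \<open>x\<close> and \<open>y\<close> share a block and nothing otherwise. Block \<open>0\<close> has
  \<open>2^v\<close> elements of weight \<open>4^-v / 8\<close> for every level \<open>v\<close>, in total
  \<open>1/4\<close>. Block \<open>v + 1\<close> arises from it by enlarging level \<open>v\<close> to
  \<open>4^(v+1)\<close> elements, which makes its weight at least \<open>1/2\<close>. Since \<open>m\<close>
  rounds cannot tell large levels apart, block \<open>0\<close> may be removed without Spoiler noticing,
  but the cost of \<open>\<exists>x \<forall>y. R(x, y)\<close> jumps.
\<close>

section \<open>Cost semirings\<close>

text \<open>The bound \<open>1 \<le> top_cost\<close> leaves room below the cost of
  \<open>\<zero>\<close> for all edge weights and for the thresholds 1/4 and 1/2.\<close>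

locale cost_semiring =
  fixes S :: "'s ring" (structure)
    and cost :: "'s \<Rightarrow> ennreal"
    and top_cost :: ennreal
  assumes cost_bij: "bij_betw cost (carrier S) {..top_cost}"
    and one_le_top_cost: "1 \<le> top_cost"
    and add_closed: "\<And>s t. s \<in> carrier S \<Longrightarrow> t \<in> carrier S \<Longrightarrow> s \<oplus> t \<in> carrier S"
    and mult_closed: "\<And>s t. s \<in> carrier S \<Longrightarrow> t \<in> carrier S \<Longrightarrow> s \<otimes> t \<in> carrier S"
    and zero_closed: "\<zero> \<in> carrier S"
    and one_closed: "\<one> \<in> carrier S"
    and cost_add:
      "\<And>s t. s \<in> carrier S \<Longrightarrow> t \<in> carrier S \<Longrightarrow> cost (s \<oplus> t) = min (cost s) (cost t)"
    and cost_mult: "\<And>s t. s \<in> carrier S \<Longrightarrow> t \<in> carrier S \<Longrightarrow>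
      cost (s \<otimes> t) = min top_cost (cost s + cost t)"
    and cost_zero: "cost \<zero> = top_cost"
    and cost_one: "cost \<one> = 0"
begin

lemma cost_le_top: "s \<in> carrier S \<Longrightarrow> cost s \<le> top_cost"
  using cost_bij by (auto simp: bij_betw_def)

lemma cost_inject: "s \<in> carrier S \<Longrightarrow> t \<in> carrier S \<Longrightarrow> cost s = cost t \<longleftrightarrow> s = t"
  using cost_bij by (auto simp: bij_betw_def inj_on_def)

lemma cost_surj:
  assumes "r \<le> top_cost"
  obtains s where "s \<in> carrier S" "cost s = r"
proof -
  have "r \<in> cost ` carrier S"
    using cost_bij assms by (auto simp: bij_betw_def)
  then show ?thesis
    using that by blast
qed

definition of_cost :: "ennreal \<Rightarrow> 's" where
  "of_cost r = inv_into (carrier S) cost r"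

lemma of_cost:
  assumes "r \<le> top_cost"
  shows of_cost_closed: "of_cost r \<in> carrier S" and cost_of_cost: "cost (of_cost r) = r"
  using assms cost_bij unfolding of_cost_def bij_betw_def
  by (auto intro!: inv_into_into f_inv_into_f)

text \<open>If \<open>a\<close> exceeds \<open>top_cost\<close>, both sides equal
  \<open>top_cost\<close>. Early truncation is therefore harmless, which makes truncated addition
  associative.\<close>

lemma min_top_add: "min top_cost (min top_cost a + b) = min top_cost (a + b)"
proof (cases "a \<le> top_cost")
  case False
  then have "top_cost \<le> a + b" "top_cost \<le> top_cost + b"
    by (simp_all add: add_increasing2)
  then show ?thesis
    using False by (simp add: min_def)
qed (simp add: min_absorb2)

lemma min_top_add_right: "min top_cost (a + min top_cost b) = min top_cost (a + b)"
  using min_top_add[of b a] by (simp add: add.commute)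

text \<open>Each law holds for costs and is pulled back along the injectivity of
  \<open>cost\<close>.\<close>

sublocale comm_monoid S
proof (rule comm_monoidI)
  fix x y z
  assume xyz: "x \<in> carrier S" "y \<in> carrier S" "z \<in> carrier S"
  have "cost (x \<otimes> y \<otimes> z) = min top_cost (cost x + cost y + cost z)"
    using xyz by (simp add: cost_mult mult_closed min_top_add)
  also have "\<dots> = cost (x \<otimes> (y \<otimes> z))"
    using xyz by (simp add: cost_mult mult_closed min_top_add_right add.assoc)
  finally show "x \<otimes> y \<otimes> z = x \<otimes> (y \<otimes> z)"
    using xyz by (simp add: cost_inject mult_closed)
next
  fix x assume x: "x \<in> carrier S"
  then have "cost (\<one> \<otimes> x) = cost x"
    by (simp add: cost_mult one_closed cost_one cost_le_top min_absorb2)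
  then show "\<one> \<otimes> x = x"
    using x by (simp add: cost_inject mult_closed one_closed)
next
  fix x y assume xy: "x \<in> carrier S" "y \<in> carrier S"
  then have "cost (x \<otimes> y) = cost (y \<otimes> x)"
    by (simp add: cost_mult add.commute)
  then show "x \<otimes> y = y \<otimes> x"
    using xy by (simp add: cost_inject mult_closed)
qed (auto simp: mult_closed one_closed)

sublocale abelian_monoid S
proof (rule abelian_monoidI)
  fix x y z
  assume xyz: "x \<in> carrier S" "y \<in> carrier S" "z \<in> carrier S"
  then have "cost (x \<oplus> y \<oplus> z) = cost (x \<oplus> (y \<oplus> z))"
    by (simp add: cost_add add_closed min.assoc)
  then show "x \<oplus> y \<oplus> z = x \<oplus> (y \<oplus> z)"
    using xyz by (simp add: cost_inject add_closed)
next
  fix x assume x: "x \<in> carrier S"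
  then have "cost (\<zero> \<oplus> x) = cost x"
    by (simp add: cost_add zero_closed cost_zero cost_le_top min_absorb2)
  then show "\<zero> \<oplus> x = x"
    using x by (simp add: cost_inject add_closed zero_closed)
next
  fix x y assume xy: "x \<in> carrier S" "y \<in> carrier S"
  then have "cost (x \<oplus> y) = cost (y \<oplus> x)"
    by (simp add: cost_add min.commute)
  then show "x \<oplus> y = y \<oplus> x"
    using xy by (simp add: cost_inject add_closed)
qed (auto simp: add_closed zero_closed)

section \<open>Infima and suprema in the natural order\<close>

lemma natural_order_carrier [simp]: "carrier (natural_order S) = carrier S"
  by (simp add: natural_order_def)

lemma natural_order_le:
  assumes "s \<in> carrier S" "t \<in> carrier S"
  shows "s \<sqsubseteq>\<^bsub>natural_order S\<^esub> t \<longleftrightarrow> cost t \<le> cost s"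
proof
  assume "s \<sqsubseteq>\<^bsub>natural_order S\<^esub> t"
  then show "cost t \<le> cost s"
    using assms by (auto simp: natural_order_def cost_add)
next
  assume "cost t \<le> cost s"
  \<comment> \<open>The witness for the natural order is \<open>t\<close> itself.\<close>
  then have "cost (s \<oplus> t) = cost t"
    using assms by (simp add: cost_add min_absorb2)
  then have "s \<oplus> t = t"
    using assms by (simp add: cost_inject add_closed)
  then show "s \<sqsubseteq>\<^bsub>natural_order S\<^esub> t"
    using assms by (auto simp: natural_order_def)
qed

text \<open>Costs fill the whole interval up to \<open>top_cost\<close>, so the supremum of the
  costs is attained by an element; as the order is reversed, this element is the greatest lower
  bound.\<close>

lemma inf_natural_order:
  assumes X: "X \<subseteq> carrier S"
  shows inf_natural_order_closed: "\<Sqinter>\<^bsub>natural_order S\<^esub>X \<in> carrier S"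
    and cost_inf: "cost (\<Sqinter>\<^bsub>natural_order S\<^esub>X) = (SUP x\<in>X. cost x)"
proof -
  let ?L = "natural_order S" and ?P = "\<lambda>s. greatest (natural_order S) s (Lower (natural_order S) X)"
  have "(SUP x\<in>X. cost x) \<le> top_cost"
    using X by (auto intro!: SUP_least cost_le_top)
  then obtain s where s: "s \<in> carrier S" "cost s = (SUP x\<in>X. cost x)"
    by (rule cost_surj)
  have mem: "u \<in> Lower ?L X \<longleftrightarrow> u \<in> carrier S \<and> (SUP x\<in>X. cost x) \<le> cost u" for u
    using X by (auto simp: Lower_def natural_order_le subset_iff SUP_le_iff)
  have Ps: "?P s"
    unfolding greatest_def using s by (auto simp: mem natural_order_le)
  \<comment> \<open>The lattice operation is a Hilbert choice, so its value is known only once the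
    greatest lower bound is shown to be unique.\<close>
  have "t = s" if "?P t" for t
  proof -
    have "t \<in> carrier S" "cost t = cost s"
      using that Ps unfolding greatest_def by (auto simp: mem natural_order_le intro: antisym)
    then show ?thesis
      using s cost_inject by metis
  qed
  then have "\<Sqinter>\<^bsub>?L\<^esub>X = s"
    unfolding inf_def by (intro some_equality Ps)
  then show "\<Sqinter>\<^bsub>?L\<^esub>X \<in> carrier S" "cost (\<Sqinter>\<^bsub>?L\<^esub>X) = (SUP x\<in>X. cost x)"
    using s by auto
qed

lemma sup_natural_order:
  assumes X: "X \<subseteq> carrier S" "X \<noteq> {}"
  shows sup_natural_order_closed: "\<Squnion>\<^bsub>natural_order S\<^esub>X \<in> carrier S"
    and cost_sup: "cost (\<Squnion>\<^bsub>natural_order S\<^esub>X) = (INF x\<in>X. cost x)"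
proof -
  let ?L = "natural_order S" and ?P = "\<lambda>s. least (natural_order S) s (Upper (natural_order S) X)"
  \<comment> \<open>An empty infimum in \<open>ennreal\<close> is infinite and could lie above
    \<open>top_cost\<close>.\<close>
  obtain x where "x \<in> X" using X by blast
  then have "(INF x\<in>X. cost x) \<le> top_cost"
    using X by (intro INF_lower2[of x]) (auto intro: cost_le_top)
  then obtain s where s: "s \<in> carrier S" "cost s = (INF x\<in>X. cost x)"
    by (rule cost_surj)
  have mem: "u \<in> Upper ?L X \<longleftrightarrow> u \<in> carrier S \<and> cost u \<le> (INF x\<in>X. cost x)" for u
    using X by (auto simp: Upper_def natural_order_le subset_iff le_INF_iff)
  have Ps: "?P s"
    unfolding least_def using s by (auto simp: mem natural_order_le)
  have "t = s" if "?P t" for t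
  proof -
    have "t \<in> carrier S" "cost t = cost s"
      using that Ps unfolding least_def by (auto simp: mem natural_order_le intro: antisym)
    then show ?thesis
      using s cost_inject by metis
  qed
  then have "\<Squnion>\<^bsub>?L\<^esub>X = s"
    unfolding sup_def by (intro some_equality Ps)
  then show "\<Squnion>\<^bsub>?L\<^esub>X \<in> carrier S" "cost (\<Squnion>\<^bsub>?L\<^esub>X) = (INF x\<in>X. cost x)"
    using s by auto
qed

section \<open>Costs of finite and infinite sums and products\<close>

lemma cost_finprod:
  assumes "finite F" "f \<in> F \<rightarrow> carrier S"
  shows "cost (finprod S f F) = min top_cost (\<Sum>i\<in>F. cost (f i))"
  using assms
proof (induction F rule: finite_induct)
  case (insert i F)
  then have "cost (finprod S f (insert i F)) =
      min top_cost (cost (f i) + min top_cost (\<Sum>i\<in>F. cost (f i)))"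
    by (simp add: cost_mult finprod_closed)
  then show ?case
    using insert by (simp add: min_top_add_right)
qed (simp add: cost_one)

text \<open>The truncation accounts for the empty sum: \<open>\<zero>\<close> costs
  \<open>top_cost\<close>, while the infimum over the empty set is infinite.\<close>

lemma cost_finsum:
  assumes "finite F" "f \<in> F \<rightarrow> carrier S"
  shows "cost (finsum S f F) = min top_cost (INF i\<in>F. cost (f i))"
  using assms
proof (induction F rule: finite_induct)
  case (insert i F)
  then have "cost (finsum S f (insert i F)) =
      min (cost (f i)) (min top_cost (INF i\<in>F. cost (f i)))"
    by (simp add: cost_add finsum_insert finsum_closed)
  then show ?case
    by (simp add: inf_min min.left_commute)
qed (simp add: cost_zero finsum_empty)

lemma inf_prod:
  assumes f: "f \<in> I \<rightarrow> carrier S"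
  shows inf_prod_closed: "inf_prod S f I \<in> carrier S"
    and cost_inf_prod: "cost (inf_prod S f I) =
      (SUP F\<in>{F. finite F \<and> F \<subseteq> I}. min top_cost (\<Sum>i\<in>F. cost (f i)))"
proof -
  let ?Fs = "{F. finite F \<and> F \<subseteq> I}"
  have restr: "f \<in> F \<rightarrow> carrier S" if "F \<subseteq> I" for F
    using f that by auto
  have sub: "finprod S f ` ?Fs \<subseteq> carrier S"
    using restr by (auto intro!: finprod_closed)
  show "inf_prod S f I \<in> carrier S"
    unfolding inf_prod_def infi_def using sub by (rule inf_natural_order_closed)
  have "cost (inf_prod S f I) = (SUP F\<in>?Fs. cost (finprod S f F))"
    unfolding inf_prod_def infi_def using cost_inf[OF sub] by (simp add: image_image)
  also have "\<dots> = (SUP F\<in>?Fs. min top_cost (\<Sum>i\<in>F. cost (f i)))"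
    using restr by (intro SUP_cong) (auto simp: cost_finprod)
  finally show "cost (inf_prod S f I) = (SUP F\<in>?Fs. min top_cost (\<Sum>i\<in>F. cost (f i)))" .
qed

lemma cost_inf_sum:
  assumes f: "f \<in> I \<rightarrow> carrier S"
  shows "cost (inf_sum S f I) = min top_cost (INF i\<in>I. cost (f i))"
proof -
  let ?Fs = "{F. finite F \<and> F \<subseteq> I}"
  have restr: "f \<in> F \<rightarrow> carrier S" if "F \<subseteq> I" for F
    using f that by auto
  have "finsum S f ` ?Fs \<subseteq> carrier S" "finsum S f ` ?Fs \<noteq> {}"
    using restr by (auto intro!: finsum_closed)
  then have "cost (inf_sum S f I) = (INF F\<in>?Fs. cost (finsum S f F))"
    unfolding inf_sum_def supr_def by (subst cost_sup) (simp_all add: image_image)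
  also have "\<dots> = (INF F\<in>?Fs. min top_cost (INF i\<in>F. cost (f i)))"
    using restr by (intro INF_cong) (auto simp: cost_finsum)
  also have "\<dots> = min top_cost (INF i\<in>I. cost (f i))"
  proof (rule antisym)
    \<comment> \<open>The empty partial sum yields the bound \<open>top_cost\<close>; singletons
      yield the individual costs.\<close>
    have "(INF F\<in>?Fs. min top_cost (INF i\<in>F. cost (f i))) \<le> top_cost"
      by (rule INF_lower2[of "{}"]) auto
    moreover have "(INF F\<in>?Fs. min top_cost (INF i\<in>F. cost (f i))) \<le> cost (f i)" if "i \<in> I" for i
      using that by (intro INF_lower2[of "{i}"]) auto
    ultimately show "(INF F\<in>?Fs. min top_cost (INF i\<in>F. cost (f i))) \<le>
        min top_cost (INF i\<in>I. cost (f i))"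
      by (auto intro: INF_greatest)
  next
    have "min top_cost (INF i\<in>I. cost (f i)) \<le> cost (f i)" if "i \<in> I" for i
      using INF_lower[OF that] by (rule min.coboundedI2)
    then show "min top_cost (INF i\<in>I. cost (f i)) \<le>
        (INF F\<in>?Fs. min top_cost (INF i\<in>F. cost (f i)))"
      by (intro INF_greatest min.boundedI min.cobounded1 INF_greatest) blast
  qed
  finally show ?thesis .
qed

end


section \<open>Counting colours suffices for Duplicator\<close>

text \<open>The chosen pairs form a colour-preserving partial bijection. Each side has its own
  colouring, so that a renaming of blocks can be built into one of them.\<close>

definition position_inv ::
    "'a set \<Rightarrow> ('a \<Rightarrow> 'c) \<Rightarrow> 'b set \<Rightarrow> ('b \<Rightarrow> 'c) \<Rightarrow> ('a \<times> 'b) list \<Rightarrow> bool" where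
  "position_inv A cA B cB p \<longleftrightarrow>
    (\<forall>(a, b)\<in>set p. a \<in> A \<and> b \<in> B \<and> cA a = cB b) \<and>
    (\<forall>(a, b)\<in>set p. \<forall>(a', b')\<in>set p. a = a' \<longleftrightarrow> b = b')"

text \<open>Reduces Spoiler's moves in \<open>B\<close> to those in \<open>A\<close>.\<close>

lemma position_inv_swap:
  "position_inv B cB A cA (map prod.swap p) \<longleftrightarrow> position_inv A cA B cB p"
  unfolding position_inv_def by (simp add: case_prod_beta eq_commute) blast

lemma position_inv_append:
  "position_inv A cA B cB (p @ [(a, b)]) \<longleftrightarrow>
    position_inv A cA B cB p \<and> a \<in> A \<and> b \<in> B \<and> cA a = cB b \<and>
    (\<forall>(a', b')\<in>set p. a' = a \<longleftrightarrow> b' = b)"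
  unfolding position_inv_def by (simp add: case_prod_beta eq_commute ball_conj_distrib) blast

lemma position_inv_extend:
  assumes inv: "position_inv A cA B cB p" and len: "length p < m" and a: "a \<in> A"
    and fin: "finite {x\<in>A. cA x = cA a}"
    and card: "min m (card {x\<in>A. cA x = cA a}) = min m (card {y\<in>B. cB y = cA a})"
  shows "\<exists>b\<in>B. position_inv A cA B cB (p @ [(a, b)])"
proof -
  have mem: "x \<in> A" "y \<in> B" "cA x = cB y" if "(x, y) \<in> set p" for x y
    using inv that unfolding position_inv_def by auto
  have iff: "x = x' \<longleftrightarrow> y = y'" if "(x, y) \<in> set p" "(x', y') \<in> set p" for x y x' y'
    using inv that unfolding position_inv_def by blast
  show ?thesis
  proof (cases "\<exists>b. (a, b) \<in> set p")
    case True
    then obtain b where b: "(a, b) \<in> set p"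
      by blast
    then have "\<forall>(x, y)\<in>set p. x = a \<longleftrightarrow> y = b"
      using iff by blast
    then have "position_inv A cA B cB (p @ [(a, b)])"
      using inv mem[OF b] by (simp add: position_inv_append)
    then show ?thesis
      using mem(2)[OF b] by blast
  next
    case False
    let ?P = "{q \<in> set p. cA (fst q) = cA a}"
    let ?A = "{x\<in>A. cA x = cA a}" and ?B = "{y\<in>B. cB y = cA a}"
    have "inj_on fst ?P" "inj_on snd ?P"
      by (auto intro!: inj_onI dest: iff)
    then have cards: "card (fst ` ?P) = card ?P" "card (snd ` ?P) = card ?P"
      by (auto simp: card_image)
    have "fst ` ?P \<subseteq> ?A - {a}"
      using mem False by auto
    then have "fst ` ?P \<subset> ?A"
      using a by blast
    then have "card ?P < card ?A"
      using psubset_card_mono[OF fin, of "fst ` ?P"] cards by simp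
    moreover have "card ?P < m"
      using len card_length[of p] card_mono[of "set p" ?P] by auto
    ultimately have "card (snd ` ?P) < card ?B"
      using card cards by linarith
    then have "\<not> ?B \<subseteq> snd ` ?P"
      using card_mono[of "snd ` ?P" ?B] by auto
    then obtain b where b: "b \<in> ?B" "b \<notin> snd ` ?P"
      by blast
    \<comment> \<open>Any pair containing \<open>b\<close> would have the colour of \<open>a\<close>
      and hence lie in \<open>?P\<close>, so \<open>b\<close> is new to the whole position.\<close>
    have "\<forall>(x, y)\<in>set p. x = a \<longleftrightarrow> y = b"
      using b mem False by (force simp: image_iff)
    then have "position_inv A cA B cB (p @ [(a, b)])"
      using inv a b by (simp add: position_inv_append)
    then show ?thesis
      using b by blast
  qed
qed

lemma winning_strategy_if_colour_counts:
  assumes ne: "A \<noteq> {}" "B \<noteq> {}"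
    and fin: "\<And>t. finite {a\<in>A. cA a = t}" "\<And>t. finite {b\<in>B. cB b = t}"
    and card: "\<And>t. min m (card {a\<in>A. cA a = t}) = min m (card {b\<in>B. cB b = t})"
    and iso: "\<And>p. position_inv A cA B cB p \<Longrightarrow> local_iso \<tau> \<pi> \<pi>' p"
  shows "\<exists>f g. winning_strategy \<tau> A \<pi> B \<pi>' m f g"
proof -
  let ?inv = "position_inv A cA B cB"
  \<comment> \<open>A strategy must answer at every position, so where the invariant fails or all
    rounds are over an arbitrary element of \<open>B\<close> is returned.\<close>
  have "\<exists>b. b \<in> B \<and> (?inv p \<and> length p < m \<longrightarrow> ?inv (p @ [(a, b)]))" if "a \<in> A" for p a
    using position_inv_extend[where p = p, OF _ _ that fin(1) card] ne by blast
  then have "\<exists>f. \<forall>p. \<forall>a\<in>A. f p a \<in> B \<and> (?inv p \<and> length p < m \<longrightarrow> ?inv (p @ [(a, f p a)]))"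
    by (intro choice allI bchoice) blast
  then obtain f where f: "\<And>p a. a \<in> A \<Longrightarrow> f p a \<in> B"
    "\<And>p a. a \<in> A \<Longrightarrow> ?inv p \<Longrightarrow> length p < m \<Longrightarrow> ?inv (p @ [(a, f p a)])"
    by blast
  have "\<exists>a. a \<in> A \<and> (?inv p \<and> length p < m \<longrightarrow> ?inv (p @ [(a, b)]))" if b: "b \<in> B" for p b
  proof (cases "?inv p \<and> length p < m")
    case True
    then have "position_inv B cB A cA (map prod.swap p)" "length (map prod.swap p) < m"
      by (simp_all add: position_inv_swap)
    from position_inv_extend[OF this b fin(2) card[symmetric]]
    obtain a where "a \<in> A" "position_inv B cB A cA (map prod.swap (p @ [(a, b)]))"
      by auto
    then show ?thesis
      unfolding position_inv_swap by blast
  qed (use ne in blast)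
  then have "\<exists>g. \<forall>p. \<forall>b\<in>B. g p b \<in> A \<and> (?inv p \<and> length p < m \<longrightarrow> ?inv (p @ [(g p b, b)]))"
    by (intro choice allI bchoice) blast
  then obtain g where g: "\<And>p b. b \<in> B \<Longrightarrow> g p b \<in> A"
    "\<And>p b. b \<in> B \<Longrightarrow> ?inv p \<Longrightarrow> length p < m \<Longrightarrow> ?inv (p @ [(g p b, b)])"
    by blast
  have "length p \<le> m \<longrightarrow> ?inv p" if "consistent A B f g p" for p
    using that
  proof induction
    case start
    show ?case by (simp add: position_inv_def)
  qed (auto intro: f g)
  then have "winning_strategy \<tau> A \<pi> B \<pi>' m f g"
    unfolding winning_strategy_def using f(1) g(1) iso by auto
  then show ?thesis
    by blast
qed


section \<open>The two interpretations\<close>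

text \<open>Universes have to be sets of naturals, so the disjoint union of blocks is coded by
  triples of block, level and index.\<close>

definition block :: "nat \<Rightarrow> nat" where
  "block a = fst (prod_decode a)"

definition level :: "nat \<Rightarrow> nat" where
  "level a = fst (prod_decode (snd (prod_decode a)))"

definition index :: "nat \<Rightarrow> nat" where
  "index a = snd (prod_decode (snd (prod_decode a)))"

definition node :: "nat \<Rightarrow> nat \<Rightarrow> nat \<Rightarrow> nat" where
  "node i v k = prod_encode (i, prod_encode (v, k))"

lemma node_simps [simp]:
  "block (node i v k) = i" "level (node i v k) = v" "index (node i v k) = k"
  by (simp_all add: block_def level_def index_def node_def)

lemma node_collapse [simp]: "node (block a) (level a) (index a) = a"
  by (simp add: block_def level_def index_def node_def)

definition cell_size :: "nat \<Rightarrow> nat \<Rightarrow> nat" where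
  "cell_size i v = (if i = Suc v then 4 ^ v * 4 else 2 ^ v)"

definition universe :: "nat set \<Rightarrow> nat set" where
  "universe K = {a. block a \<in> K \<and> index a < cell_size (block a) (level a)}"

lemma cell_eq:
  "i \<in> K \<Longrightarrow> {a\<in>universe K. (block a, level a) = (i, v)} = node i v ` {..<cell_size i v}"
  by (force simp: universe_def image_iff intro: node_collapse[symmetric])

lemma card_cell:
  assumes "i \<in> K"
  shows "finite {a\<in>universe K. (block a, level a) = (i, v)}"
    and "card {a\<in>universe K. (block a, level a) = (i, v)} = cell_size i v"
proof -
  have "inj (node i v)"
    by (rule injI) (metis node_simps(3))
  then show "finite {a\<in>universe K. (block a, level a) = (i, v)}"
    "card {a\<in>universe K. (block a, level a) = (i, v)} = cell_size i v"
    unfolding cell_eq[OF assms] by (auto simp: card_image inj_on_subset)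
qed

lemma infinite_universe:
  assumes "i \<in> K"
  shows "infinite (universe K)"
proof
  assume "finite (universe K)"
  \<comment> \<open>No cell is empty, so every level occurs.\<close>
  moreover have "level ` universe K = UNIV"
  proof -
    have "v \<in> level ` universe K" for v
      using assms by (intro image_eqI[of _ _ "node i v 0"]) (auto simp: universe_def cell_size_def)
    then show ?thesis
      by blast
  qed
  ultimately show False
    using finite_imageI infinite_UNIV_nat by metis
qed

section \<open>Edge weights and their sums over blocks\<close>

definition edge :: "nat \<Rightarrow> nat \<Rightarrow> real" where
  "edge a b = (if block a = block b then (1 / 4) ^ level b / 8 else 0)"

lemma edge_nonneg: "0 \<le> edge a b"
  by (simp add: edge_def)

lemma edge_less_one: "edge a b < 1"
proof -
  have "(1 / 4) ^ level b \<le> (1 :: real)"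
    by (simp add: power_le_one)
  then show ?thesis
    by (simp add: edge_def)
qed

text \<open>Only elements of block 0 contribute, and \<open>F\<close> meets finitely many levels.
  Level \<open>v\<close> weighs 2^v * 4^-v / 8 = 2^-v / 8, so the geometric series bounds the
  sum.\<close>

lemma edge_sum_block_zero:
  assumes F: "finite F" "F \<subseteq> universe K" and x: "block x = 0"
  shows "(\<Sum>y\<in>F. edge x y) \<le> 1 / 4"
proof -
  \<comment> \<open>Inserting 0 keeps the maximum meaningful for empty \<open>F\<close>.\<close>
  define n where "n = Suc (Max (insert 0 (level ` F)))"
  have n: "level y < n" if "y \<in> F" for y
    using F that by (auto simp: n_def less_Suc_eq_le)
  let ?J = "SIGMA v:{..<n}. {..<2 ^ v :: nat}"
  let ?F = "(\<lambda>(v, k). node 0 v k) ` ?J"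
  have inj: "inj_on (\<lambda>(v, k). node 0 v k) ?J"
    by (rule inj_onI) (auto, (metis node_simps)+)
  have "(\<Sum>y\<in>F. edge x y) = (\<Sum>y\<in>{y\<in>F. block y = 0}. edge x y)"
    using F x by (intro sum.mono_neutral_right) (auto simp: edge_def)
  also have "\<dots> \<le> (\<Sum>y\<in>?F. edge x y)"
  proof (rule sum_mono2)
    show "{y\<in>F. block y = 0} \<subseteq> ?F"
    proof
      fix y assume y: "y \<in> {y\<in>F. block y = 0}"
      then have "y = node 0 (level y) (index y)" "index y < 2 ^ level y"
        using F node_collapse[of y] by (auto simp: universe_def cell_size_def)
      then show "y \<in> ?F"
        using y n by (intro image_eqI[of _ _ "(level y, index y)"]) auto
    qed
  qed (auto simp: edge_nonneg)
  also have "\<dots> = (\<Sum>v<n. \<Sum>k<2 ^ v. edge x (node 0 v k))"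
    by (subst sum.reindex[OF inj]) (simp add: sum.Sigma case_prod_beta comp_def)
  also have "\<dots> = (\<Sum>v<n. (1 / 2) ^ v / 8)"
    using x by (intro sum.cong) (simp_all add: edge_def flip: power_mult_distrib)
  also have "\<dots> = (1 - (1 / 2) ^ n) / 4"
    by (induction n) (simp_all add: field_simps)
  also have "\<dots> \<le> 1 / 4"
    by simp
  finally show ?thesis .
qed

text \<open>The enlarged cell has 4^(v+1) elements of weight 4^-v / 8 each.\<close>

lemma edge_sum_block_Suc:
  assumes "block x = Suc v" "Suc v \<in> K"
  shows "(\<Sum>y\<in>{a\<in>universe K. (block a, level a) = (Suc v, v)}. edge x y) = 1 / 2"
proof -
  let ?C = "{a\<in>universe K. (block a, level a) = (Suc v, v)}"
  have "(\<Sum>y\<in>?C. edge x y) = (\<Sum>y\<in>?C. (1 / 4) ^ v / 8)"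
    using assms(1) by (intro sum.cong) (auto simp: edge_def)
  also have "\<dots> = real (cell_size (Suc v) v) * ((1 / 4) ^ v / 8)"
    using card_cell(2)[OF assms(2)] by (simp only: sum_constant)
  also have "\<dots> = 1 / 2"
    by (simp add: cell_size_def power_divide)
  finally show ?thesis .
qed

text \<open>The Hilbert hotel that makes room for block \<open>0\<close> behind the blocks that
  \<open>m\<close> rounds can tell apart from it.\<close>

definition block_shift :: "nat \<Rightarrow> nat \<Rightarrow> nat" where
  "block_shift m i = (if i = 0 then Suc m else if i \<le> m then i else Suc i)"

lemma inj_block_shift: "inj (block_shift m)"
  by (auto simp: inj_def block_shift_def split: if_splits)

lemma range_block_shift: "range (block_shift m) = - {0}"
proof -
  have "i \<in> range (block_shift m)" if "i \<noteq> 0" for i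
  proof (cases "i \<le> m \<or> i = Suc m")
    case True
    then show ?thesis
      using that by (intro image_eqI[of _ _ "if i = Suc m then 0 else i"]) (auto simp: block_shift_def)
  next
    case False
    then show ?thesis
      by (intro image_eqI[of _ _ "i - 1"]) (auto simp: block_shift_def)
  qed
  then show ?thesis
    by (auto simp: block_shift_def split: if_splits)
qed

text \<open>A cell enlarged at a level \<open>v < m\<close> belongs to block
  \<open>v + 1 \<le> m\<close>, which the shift fixes; the blocks that move, and their images, are
  enlarged only at level \<open>m\<close> or above, if at all. From level \<open>m\<close> on every
  cell has at least \<open>m\<close> elements.\<close>

lemma min_cell_size_shift: "min m (cell_size (block_shift m i) v) = min m (cell_size i v)"
proof (cases "v < m")
  case True
  then show ?thesis
    by (auto simp: block_shift_def cell_size_def)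
next
  case False
  have "m \<le> 2 ^ v"
    using False less_exp[of v] by linarith
  moreover have "(2 :: nat) ^ v \<le> 4 ^ v * 4"
    using power_mono[of "2 :: nat" 4 v] by simp
  ultimately have "m \<le> cell_size j v" for j
    unfolding cell_size_def by simp
  then show ?thesis
    by (simp add: min_absorb1)
qed

section \<open>The interpretation and Duplicator's win\<close>

context cost_semiring
begin

text \<open>Every atom counts as true, with value \<open>\<one>\<close> across different blocks; all
  information lies in the values of the positive literals.\<close>

definition edge_interp :: "(nat, nat) literal \<Rightarrow> 's" where
  "edge_interp l = (case l of
     Pos R as \<Rightarrow> of_cost (ennreal (edge (as ! 0) (as ! 1)))
   | Neg R as \<Rightarrow> \<zero>)"

definition edge_vocab :: "nat vocab" where
  "edge_vocab = [0 \<mapsto> 2]"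

lemma edge_interp_Pos:
  "edge_interp (Pos R as) \<in> carrier S"
  "cost (edge_interp (Pos R as)) = ennreal (edge (as ! 0) (as ! 1))"
proof -
  have "ennreal (edge (as ! 0) (as ! 1)) \<le> 1"
    using edge_less_one[of "as ! 0" "as ! 1"] by simp
  then have "ennreal (edge (as ! 0) (as ! 1)) \<le> top_cost"
    using one_le_top_cost by (rule order_trans)
  then show "edge_interp (Pos R as) \<in> carrier S"
    "cost (edge_interp (Pos R as)) = ennreal (edge (as ! 0) (as ! 1))"
    by (simp_all add: edge_interp_def of_cost_closed cost_of_cost)
qed

lemma interpretation_edge_interp: "interpretation_on S \<tau> A edge_interp"
  unfolding interpretation_on_def literals_def
  using edge_interp_Pos(1) by (auto simp: edge_interp_def zero_closed)

lemma model_defining_edge_interp: "model_defining S \<tau> A edge_interp"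
proof -
  have "edge_interp (Pos R as) \<noteq> \<zero>" for R as
  proof
    assume "edge_interp (Pos R as) = \<zero>"
    \<comment> \<open>Impossible, since edge weights stay strictly below 1.\<close>
    then have "ennreal (edge (as ! 0) (as ! 1)) = top_cost"
      using edge_interp_Pos(2)[of R as] cost_zero by simp
    then show False
      using one_le_top_cost edge_less_one[of "as ! 0" "as ! 1"] by (metis ennreal_ge_1 not_less)
  qed
  then show ?thesis
    by (simp add: model_defining_def edge_interp_def)
qed

text \<open>An edge depends only on the level of its target and on whether the blocks coincide, so
  an injective renaming of blocks is invisible.\<close>

lemma local_iso_edge_interp:
  assumes inv: "position_inv A (\<lambda>a. (block a, level a)) B (\<lambda>b. (\<sigma> (block b), level b)) p"
    and inj: "inj \<sigma>"
  shows "local_iso edge_vocab edge_interp edge_interp p"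
proof -
  have nth: "block (fst (p ! i)) = \<sigma> (block (snd (p ! i)))" "level (fst (p ! i)) = level (snd (p ! i))"
    if "i < length p" for i
    using inv nth_mem[OF that] unfolding position_inv_def by (auto simp: case_prod_beta)
  have edges: "edge (fst (p ! i)) (fst (p ! j)) = edge (snd (p ! i)) (snd (p ! j))"
    if "i < length p" "j < length p" for i j
    using that inj by (simp add: edge_def nth inj_eq)
  have "fst (p ! i) = fst (p ! j) \<longleftrightarrow> snd (p ! i) = snd (p ! j)"
    if "i < length p" "j < length p" for i j
    using inv nth_mem[OF that(1)] nth_mem[OF that(2)] unfolding position_inv_def case_prod_beta
    by blast
  moreover have "edge_interp (Pos R (map (\<lambda>j. fst (p ! j)) js)) =
      edge_interp (Pos R (map (\<lambda>j. snd (p ! j)) js))"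
    if "edge_vocab R = Some (length js)" "set js \<subseteq> {..<length p}" for R js
  proof -
    have "length js = 2"
      using that(1) by (auto simp: edge_vocab_def split: if_splits)
    then obtain i j where "js = [i, j]"
      by (auto simp: numeral_2_eq_2 length_Suc_conv)
    then show ?thesis
      using that(2) edges by (simp add: edge_interp_def)
  qed
  ultimately show ?thesis
    unfolding local_iso_def by (auto simp: edge_interp_def)
qed

lemma duplicator_wins_edge_interp:
  "duplicator_wins_G edge_vocab (universe (- {0})) edge_interp (universe UNIV) edge_interp"
proof -
  have "\<exists>f g. winning_strategy edge_vocab (universe (- {0})) edge_interp (universe UNIV) edge_interp m f g"
    for m
  proof (rule winning_strategy_if_colour_counts)
    show "universe (- {0}) \<noteq> {}" "universe UNIV \<noteq> {}"
      by (rule infinite_imp_nonempty, rule infinite_universe[of 1], simp)+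
    have cells: "finite {a\<in>universe (- {0}). (block a, level a) = t} \<and>
        finite {b\<in>universe UNIV. (block_shift m (block b), level b) = t} \<and>
        min m (card {a\<in>universe (- {0}). (block a, level a) = t}) =
          min m (card {b\<in>universe UNIV. (block_shift m (block b), level b) = t})" for t
    proof (cases "fst t = 0")
      \<comment> \<open>The shift avoids block 0, so this colour occurs on neither side.\<close>
      case True
      then have empty: "{a\<in>universe (- {0}). (block a, level a) = t} = {}"
        "{b\<in>universe UNIV. (block_shift m (block b), level b) = t} = {}"
        by (auto simp: universe_def block_shift_def split: if_splits)
      show ?thesis
        unfolding empty by simp
    next
      case False
      then obtain i v where t: "t = (block_shift m i, v)"
        using range_block_shift[of m] by (cases t) auto
      have eq: "{b\<in>universe UNIV. (block_shift m (block b), level b) = t} =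
          {b\<in>universe UNIV. (block b, level b) = (i, v)}"
        by (simp add: t inj_eq[OF inj_block_shift])
      have "block_shift m i \<in> - {0}"
        by (simp add: block_shift_def)
      then show ?thesis
        unfolding eq unfolding t by (simp only: card_cell UNIV_I min_cell_size_shift simp_thms)
    qed
    then show "finite {a\<in>universe (- {0}). (block a, level a) = t}"
      "finite {b\<in>universe UNIV. (block_shift m (block b), level b) = t}"
      "min m (card {a\<in>universe (- {0}). (block a, level a) = t}) =
        min m (card {b\<in>universe UNIV. (block_shift m (block b), level b) = t})" for t
      by blast+
  qed (rule local_iso_edge_interp[OF _ inj_block_shift])
  then show ?thesis
    unfolding duplicator_wins_G_def by metis
qed

section \<open>The cost of the separating sentence\<close>

lemma cost_row:
  "inf_prod S (\<lambda>y. edge_interp (Pos 0 [x, y])) A \<in> carrier S"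
  "cost (inf_prod S (\<lambda>y. edge_interp (Pos 0 [x, y])) A) =
    (SUP F\<in>{F. finite F \<and> F \<subseteq> A}. min top_cost (ennreal (\<Sum>y\<in>F. edge x y)))"
proof -
  have "(\<lambda>y. edge_interp (Pos 0 [x, y])) \<in> A \<rightarrow> carrier S"
    by (simp add: edge_interp_Pos)
  from inf_prod[OF this]
  show "inf_prod S (\<lambda>y. edge_interp (Pos 0 [x, y])) A \<in> carrier S"
    "cost (inf_prod S (\<lambda>y. edge_interp (Pos 0 [x, y])) A) =
      (SUP F\<in>{F. finite F \<and> F \<subseteq> A}. min top_cost (ennreal (\<Sum>y\<in>F. edge x y)))"
    by (simp_all add: edge_interp_Pos edge_nonneg)
qed

definition row_sentence :: "nat fm" where
  "row_sentence = Ex 0 (All 1 (Rel 0 [0, 1]))"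

text \<open>The inner product adds up the weights in the block of \<open>x\<close>; the outer sum
  takes the infimum over the choices of \<open>x\<close>.\<close>

lemma cost_row_sentence:
  "cost (sentence_value S A edge_interp row_sentence) =
    min top_cost (INF x\<in>A. SUP F\<in>{F. finite F \<and> F \<subseteq> A}. min top_cost (ennreal (\<Sum>y\<in>F. edge x y)))"
proof -
  have "sentence_value S A edge_interp row_sentence =
      inf_sum S (\<lambda>x. inf_prod S (\<lambda>y. edge_interp (Pos 0 [x, y])) A) A"
    by (simp add: sentence_value_def row_sentence_def)
  then show ?thesis
    by (simp add: cost_inf_sum cost_row)
qed

lemma cost_row_sentence_with_block_zero:
  "cost (sentence_value S (universe UNIV) edge_interp row_sentence) \<le> ennreal (1 / 4)"
proof -
  have "node 0 0 0 \<in> universe UNIV"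
    by (simp add: universe_def cell_size_def)
  moreover have "(SUP F\<in>{F. finite F \<and> F \<subseteq> universe UNIV}.
      min top_cost (ennreal (\<Sum>y\<in>F. edge (node 0 0 0) y))) \<le> ennreal (1 / 4)"
    by (rule SUP_least)
      (auto intro!: min.coboundedI2 ennreal_leI edge_sum_block_zero[of _ UNIV])
  ultimately show ?thesis
    unfolding cost_row_sentence by (intro min.coboundedI2 INF_lower2)
qed

lemma cost_row_sentence_without_block_zero:
  "ennreal (1 / 2) \<le> cost (sentence_value S (universe (- {0})) edge_interp row_sentence)"
proof -
  have "ennreal (1 / 2) \<le> 1"
    unfolding ennreal_le_1 by simp
  then have half: "ennreal (1 / 2) \<le> top_cost"
    using one_le_top_cost by (rule order_trans)
  have "ennreal (1 / 2) \<le> (SUP F\<in>{F. finite F \<and> F \<subseteq> universe (- {0})}.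
      min top_cost (ennreal (\<Sum>y\<in>F. edge x y)))" if "x \<in> universe (- {0})" for x
  proof -
    obtain v where v: "block x = Suc v"
      using \<open>x \<in> universe (- {0})\<close> by (auto simp: universe_def gr0_conv_Suc)
    have K: "Suc v \<in> - {0}"
      by simp
    \<comment> \<open>The enlarged cell in the block of \<open>x\<close> is a finite set that
      already weighs 1/2.\<close>
    let ?C = "{a\<in>universe (- {0}). (block a, level a) = (Suc v, v)}"
    have "ennreal (1 / 2) \<le> min top_cost (ennreal (\<Sum>y\<in>?C. edge x y))"
      unfolding edge_sum_block_Suc[OF v K] using half order_refl by (rule min.boundedI)
    moreover have "?C \<in> {F. finite F \<and> F \<subseteq> universe (- {0})}"
      using card_cell(1)[OF K] by blast
    ultimately show ?thesis
      by (rule SUP_upper2[rotated])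
  qed
  then show ?thesis
    unfolding cost_row_sentence using half by (auto intro: INF_greatest)
qed

lemma G_not_sound: "G_not_sound S"
proof -
  have "\<not> elem_equiv S edge_vocab (universe (- {0})) edge_interp (universe UNIV) edge_interp"
  proof
    assume "elem_equiv S edge_vocab (universe (- {0})) edge_interp (universe UNIV) edge_interp"
    moreover have "sentence edge_vocab row_sentence"
      by (auto simp: sentence_def row_sentence_def edge_vocab_def)
    ultimately have "ennreal (1 / 2) \<le> ennreal (1 / 4)"
      using cost_row_sentence_with_block_zero cost_row_sentence_without_block_zero
      unfolding elem_equiv_def by (metis order_trans)
    then show False
      unfolding ennreal_le_iff2 by simp
  qed
  moreover have "finite (dom edge_vocab)"
    by (simp add: edge_vocab_def)
  moreover have "infinite (universe (- {0}))" "infinite (universe UNIV)"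
    using infinite_universe[of 1] by auto
  ultimately show ?thesis
    unfolding G_not_sound_def
    using interpretation_edge_interp model_defining_edge_interp duplicator_wins_edge_interp
    by blast
qed

end


section \<open>Costs on the four semirings\<close>

lemma cost_semiring_tropical: "cost_semiring tropical (\<lambda>x. x) \<infinity>"
proof
qed (auto simp: tropical_def bij_betw_def min_def top_unique)

lemma bij_betw_ennreal_unit: "bij_betw ennreal {0..1} {..1}"
proof -
  have "enn2real r \<le> 1" if "r \<le> 1" for r
    by (rule enn2real_leI) (use that in simp_all)
  then show ?thesis
    by (intro bij_betw_byWitness[where f' = enn2real])
      (auto simp: ennreal_enn2real_if top_unique)
qed

lemma cost_semiring_doubt: "cost_semiring doubt ennreal 1"
proof
  show "bij_betw ennreal (carrier doubt) {..1}"
    by (simp add: doubt_def bij_betw_ennreal_unit)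
qed (auto simp: doubt_def min_def simp flip: ennreal_plus)

text \<open>The complement turns max(s + t - 1, 0) into min((1 - s) + (1 - t), 1), which is the
  doubt semiring.\<close>

lemma cost_semiring_lukasiewicz: "cost_semiring lukasiewicz (\<lambda>x. ennreal (1 - x)) 1"
proof
  have "bij_betw (\<lambda>x::real. 1 - x) {0..1} {0..1}"
    by (rule bij_betw_byWitness[where f' = "\<lambda>x. 1 - x"]) auto
  from bij_betw_trans[OF this bij_betw_ennreal_unit]
  show "bij_betw (\<lambda>x. ennreal (1 - x)) (carrier lukasiewicz) {..1}"
    by (simp add: lukasiewicz_def comp_def)
qed (auto simp: lukasiewicz_def min_def max_def simp flip: ennreal_plus)

text \<open>The negative logarithm turns products into sums and maxima into minima; 0 is sent to
  infinity separately.\<close>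

lemma cost_semiring_viterbi:
  "cost_semiring viterbi (\<lambda>x. if x = 0 then \<infinity> else ennreal (- ln x)) \<infinity>"
    (is "cost_semiring _ ?cost _")
proof
  show "bij_betw ?cost (carrier viterbi) {..\<infinity>}"
    by (rule bij_betw_byWitness[where f' = "\<lambda>r. if r = \<infinity> then 0 else exp (- enn2real r)"])
      (auto simp: viterbi_def ennreal_enn2real_if ln_le_zero_iff)
  show "?cost (s \<otimes>\<^bsub>viterbi\<^esub> t) = min \<infinity> (?cost s + ?cost t)"
    if "s \<in> carrier viterbi" "t \<in> carrier viterbi" for s t
    using that by (auto simp: viterbi_def ln_mult min_absorb2 simp flip: ennreal_plus)
  show "?cost (s \<oplus>\<^bsub>viterbi\<^esub> t) = min (?cost s) (?cost t)"
    if "s \<in> carrier viterbi" "t \<in> carrier viterbi" for s t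
    using that by (auto simp: viterbi_def min_def max_def ennreal_le_iff2 top_unique)
qed (auto simp: viterbi_def mult_le_one)

theorem theorem4p7:
  shows "G_not_sound tropical \<and> G_not_sound doubt \<and> G_not_sound viterbi \<and> G_not_sound lukasiewicz"
  by (intro conjI cost_semiring.G_not_sound) (fact cost_semiring_tropical cost_semiring_doubt
    cost_semiring_viterbi cost_semiring_lukasiewicz)+

end
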